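(* Let $\mathcal{R}$ be a term rewrite system. If $\mathcal{R}$ is polynomially terminating over $\mathbb{Q}$, then $\mathcal{R}$ is also polynomially terminating over $\mathbb{R}$.
   Context: Let $\mathcal{F}$ be a signature (function symbols with arities) and $\mathcal{R}$ a TRS over $\mathcal{F}$. For $D \in \{\mathbb{Q},\mathbb{R}\}$ let $D_0 = \{x \in D : x \ge 0\}$. A polynomial interpretation over $D$ consists of a number $\delta \in D$ with $\delta > 0$ and, for every $n$-ary $f \in \mathcal{F}$, a polynomial $f_D \in D[x_1,\dots,x_n]$ that is well-defined over $D_0$, i.e. $f_D(x_1,\dots,x_n) \in D_0$ for all $x_1,\dots,x_n \in D_0$. Define the order $>_{D_0,\delta}$ on $D_0$ by $x >_{D_0,\delta} y$ iff $x - y \ge \delta$. Terms are evaluated under assignments $\alpha$ of variables to elements of $D_0$ in the usual inductive way, giving $[\alpha](t)$. The interpretation is strictly monotone if every $f_D$ is monotone in each argument with respect to $>_{D_0,\delta}$ (i.e. $a_i >_{D_0,\delta} b$ implies $f_D(\dots,a_i,\dots) >_{D_0,\delta} f_D(\dots,b,\dots)$ for all arguments in $D_0$). It is compatible with $\mathcal{R}$ if $[\alpha](\ell) >_{D_0,\delta} [\alpha](r)$ for every rule $\ell \to r \in \mathcal{R}$ and every assignment $\alpha$ into $D_0$. $\mathcal{R}$ is polynomially terminating over $D$ if there is a strictly monotone polynomial interpretation over $D$ compatible with $\mathcal{R}$. *)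

theory Defs
  imports Complex_Main "HOL-Library.Poly_Mapping"
begin

datatype (funs_trm: 'f, vars_trm: 'v) trm = Var 'v | Fun 'f "('f, 'v) trm list"

(* A signature is given by a set F of function symbols and an arity function ar,
   which is only relevant on F. *)

inductive wf_trm :: "'f set \<Rightarrow> ('f \<Rightarrow> nat) \<Rightarrow> ('f, 'v) trm \<Rightarrow> bool"
  for F :: "'f set" and ar :: "'f \<Rightarrow> nat"
where
  Var: "wf_trm F ar (Var x)"
| Fun: "f \<in> F \<Longrightarrow> length ts = ar f \<Longrightarrow> (\<And>t. t \<in> set ts \<Longrightarrow> wf_trm F ar t) \<Longrightarrow> wf_trm F ar (Fun f ts)"

type_synonym ('f, 'v) rule = "('f, 'v) trm \<times> ('f, 'v) trm"

definition is_rewrite_rule :: "('f, 'v) trm \<Rightarrow> ('f, 'v) trm \<Rightarrow> bool" where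
  "is_rewrite_rule l r \<longleftrightarrow> (\<nexists>x. l = Var x) \<and> vars_trm r \<subseteq> vars_trm l"

definition is_trs :: "'f set \<Rightarrow> ('f \<Rightarrow> nat) \<Rightarrow> ('f, 'v) rule set \<Rightarrow> bool" where
  "is_trs F ar R \<longleftrightarrow>
    (\<forall>(l, r)\<in>R. wf_trm F ar l \<and> wf_trm F ar r \<and> is_rewrite_rule l r)"

(* Polynomials as the monoid algebra over exponent vectors of finite support;
   the indeterminates are numbered from 0. *)

type_synonym 'a mpoly = "(nat \<Rightarrow>\<^sub>0 nat) \<Rightarrow>\<^sub>0 'a"

definition mpoly_vars :: "'a::zero mpoly \<Rightarrow> nat set" where
  "mpoly_vars p = (\<Union>m\<in>Poly_Mapping.keys p. Poly_Mapping.keys m)"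

definition polys_in :: "nat \<Rightarrow> 'a::zero mpoly set" where
  "polys_in n = {p. mpoly_vars p \<subseteq> {..<n}}"

definition mpoly_eval :: "'a::comm_semiring_1 mpoly \<Rightarrow> 'a list \<Rightarrow> 'a" where
  "mpoly_eval p as =
    (\<Sum>m\<in>Poly_Mapping.keys p. Poly_Mapping.lookup p m *
      (\<Prod>i\<in>Poly_Mapping.keys m. (as ! i) ^ Poly_Mapping.lookup m i))"

definition nonneg :: "'a::linordered_field set" where
  "nonneg = {x. 0 \<le> x}"

definition gt_delta :: "'a::linordered_field \<Rightarrow> 'a \<Rightarrow> 'a \<Rightarrow> bool" where
  "gt_delta \<delta> x y \<longleftrightarrow> x - y \<ge> \<delta>"

definition well_defined_poly :: "nat \<Rightarrow> 'a::linordered_field mpoly \<Rightarrow> bool" where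
  "well_defined_poly n p \<longleftrightarrow>
    (\<forall>as. length as = n \<and> set as \<subseteq> nonneg \<longrightarrow> mpoly_eval p as \<in> nonneg)"

definition poly_interpretation ::
  "'f set \<Rightarrow> ('f \<Rightarrow> nat) \<Rightarrow> 'a::linordered_field \<Rightarrow> ('f \<Rightarrow> 'a mpoly) \<Rightarrow> bool" where
  "poly_interpretation F ar \<delta> I \<longleftrightarrow>
    \<delta> > 0 \<and> (\<forall>f\<in>F. I f \<in> polys_in (ar f) \<and> well_defined_poly (ar f) (I f))"

fun eval_trm :: "('f \<Rightarrow> 'a::linordered_field mpoly) \<Rightarrow> ('v \<Rightarrow> 'a) \<Rightarrow> ('f, 'v) trm \<Rightarrow> 'a" where
  "eval_trm I \<alpha> (Var x) = \<alpha> x"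
| "eval_trm I \<alpha> (Fun f ts) = mpoly_eval (I f) (map (eval_trm I \<alpha>) ts)"

definition monotone_poly :: "nat \<Rightarrow> 'a::linordered_field \<Rightarrow> 'a mpoly \<Rightarrow> bool" where
  "monotone_poly n \<delta> p \<longleftrightarrow>
    (\<forall>as b. \<forall>i<n. length as = n \<and> set as \<subseteq> nonneg \<and> b \<in> nonneg \<and> gt_delta \<delta> (as ! i) b
      \<longrightarrow> gt_delta \<delta> (mpoly_eval p as) (mpoly_eval p (as[i := b])))"

definition strictly_monotone ::
  "'f set \<Rightarrow> ('f \<Rightarrow> nat) \<Rightarrow> 'a::linordered_field \<Rightarrow> ('f \<Rightarrow> 'a mpoly) \<Rightarrow> bool" where
  "strictly_monotone F ar \<delta> I \<longleftrightarrow> (\<forall>f\<in>F. monotone_poly (ar f) \<delta> (I f))"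

definition compatible ::
  "'a::linordered_field \<Rightarrow> ('f \<Rightarrow> 'a mpoly) \<Rightarrow> ('f, 'v) rule set \<Rightarrow> bool" where
  "compatible \<delta> I R \<longleftrightarrow>
    (\<forall>(l, r)\<in>R. \<forall>\<alpha>. range \<alpha> \<subseteq> nonneg \<longrightarrow> gt_delta \<delta> (eval_trm I \<alpha> l) (eval_trm I \<alpha> r))"

(* The type argument selects the domain D of coefficients and values. *)

definition polynomially_terminating ::
  "'a::linordered_field itself \<Rightarrow> 'f set \<Rightarrow> ('f \<Rightarrow> nat) \<Rightarrow> ('f, 'v) rule set \<Rightarrow> bool" where
  "polynomially_terminating D F ar R \<longleftrightarrow>
    (\<exists>(\<delta>::'a) I. poly_interpretation F ar \<delta> I \<and> strictly_monotone F ar \<delta> I \<and> compatible \<delta> I R)"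

end

theory Submission imports Defs begin

text \<open>
  Read the rational coefficients as real ones and keep \<open>\<delta>\<close>. Every condition on the interpretation
  is a non-strict polynomial inequality which holds at all non-negative rational points, so it
  extends to the non-negative reals by density and continuity.
\<close>

abbreviation real_mpoly :: "rat mpoly \<Rightarrow> real mpoly" where
  "real_mpoly \<equiv> Poly_Mapping.map of_rat"

text \<open>Since \<open>of_rat 0 = 0\<close>, the guard that \<open>Poly_Mapping.map\<close> places
  on zero coefficients changes nothing.\<close>

lemma lookup_real_mpoly: "Poly_Mapping.lookup (real_mpoly p) m = of_rat (Poly_Mapping.lookup p m)"
  by (simp add: Poly_Mapping.map.rep_eq when_def)

text \<open>By injectivity of \<open>of_rat\<close> no coefficient vanishes, so no monomial is
  lost.\<close>

lemma keys_real_mpoly: "Poly_Mapping.keys (real_mpoly p) = Poly_Mapping.keys p"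
  by (auto simp: in_keys_iff lookup_real_mpoly)

lemma real_mpoly_in_polys_in: "p \<in> polys_in n \<Longrightarrow> real_mpoly p \<in> polys_in n"
  by (simp add: polys_in_def mpoly_vars_def keys_real_mpoly)

lemma polys_in_index_less:
  assumes "p \<in> polys_in n" "m \<in> Poly_Mapping.keys p" "i \<in> Poly_Mapping.keys m"
  shows "i < n"
  using assms by (auto simp: polys_in_def mpoly_vars_def)

text \<open>The bound on the indeterminates keeps every access \<open>qs ! i\<close> inside the
  list, where \<open>map\<close> and \<open>!\<close> commute.\<close>

lemma mpoly_eval_real_mpoly:
  assumes "p \<in> polys_in (length qs)"
  shows "mpoly_eval (real_mpoly p) (map of_rat qs) = of_rat (mpoly_eval p qs)"
  by (auto simp: mpoly_eval_def keys_real_mpoly lookup_real_mpoly of_rat_sum of_rat_mult of_rat_prod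
      of_rat_power polys_in_index_less[OF assms] intro!: sum.cong prod.cong)

text \<open>Convergence of argument lists is expressed entry by entry. The entries below
  \<open>n\<close> determine the value of \<open>p\<close>, which is a finite sum of finite products
  of them.\<close>

lemma tendsto_mpoly_eval:
  fixes p :: "real mpoly"
  assumes "p \<in> polys_in n" "\<And>i. i < n \<Longrightarrow> ((\<lambda>k. xs k ! i) \<longlongrightarrow> ys ! i) G"
  shows "((\<lambda>k. mpoly_eval p (xs k)) \<longlongrightarrow> mpoly_eval p ys) G"
  unfolding mpoly_eval_def
  by (intro tendsto_sum tendsto_mult tendsto_const tendsto_prod tendsto_power assms(2))
    (rule polys_in_index_less[OF assms(1)])

lemma tendsto_mpoly_eval_of_rat:
  assumes "p \<in> polys_in n" "\<And>k. length (qs k) = n"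
    and "\<And>i. i < n \<Longrightarrow> ((\<lambda>k. of_rat (qs k ! i)) \<longlongrightarrow> ys ! i) G"
  shows "((\<lambda>k. of_rat (mpoly_eval p (qs k))) \<longlongrightarrow> mpoly_eval (real_mpoly p) ys) G"
proof -
  have "((\<lambda>k. mpoly_eval (real_mpoly p) (map of_rat (qs k))) \<longlongrightarrow> mpoly_eval (real_mpoly p) ys) G"
    using assms by (intro tendsto_mpoly_eval[of _ n] real_mpoly_in_polys_in) auto
  then show ?thesis
    using assms(1,2) by (simp add: mpoly_eval_real_mpoly)
qed

text \<open>Induction on \<open>wf_trm\<close> provides at each node that \<open>f \<in> F\<close>
  and that the number of arguments is \<open>ar f\<close>, so that the limit for the polynomial
  \<open>I f\<close> applies.\<close>

lemma tendsto_eval_trm_of_rat: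
  assumes "wf_trm F ar t" "\<And>f. f \<in> F \<Longrightarrow> I f \<in> polys_in (ar f)"
    and "\<And>x. ((\<lambda>k. of_rat (\<beta> k x)) \<longlongrightarrow> \<alpha> x) G"
  shows "((\<lambda>k. of_rat (eval_trm I (\<beta> k) t)) \<longlongrightarrow> eval_trm (real_mpoly \<circ> I) \<alpha> t) G"
  using assms(1)
proof induction
  case (Var x)
  then show ?case using assms(3) by simp
next
  case (Fun f ts)
  then show ?case
    by (auto intro!: tendsto_mpoly_eval_of_rat[where n = "ar f"] assms(2))
qed

text \<open>Choosing the rationals strictly above \<open>x\<close> keeps them non-negative even at
  \<open>x = 0\<close>.\<close>

lemma nonneg_real_rat_seq:
  assumes "(x::real) \<in> nonneg"
  shows "\<exists>q. range q \<subseteq> nonneg \<and> (\<lambda>k::nat. of_rat (q k)) \<longlonglongrightarrow> x"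
proof -
  have "\<exists>r. x < of_rat r \<and> of_rat r < x + 1 / real (Suc k)" for k
    by (intro of_rat_dense) simp
  then obtain q where q: "\<And>k. x < of_rat (q k)" "\<And>k. of_rat (q k) < x + 1 / real (Suc k)"
    by metis
  have "0 < (of_rat (q k) :: real)" for k
    using assms by (intro le_less_trans[OF _ q(1)]) (simp add: nonneg_def)
  moreover have "(\<lambda>k. x + 1 / real (Suc k)) \<longlonglongrightarrow> x + 0"
    by (intro tendsto_add tendsto_const LIMSEQ_Suc lim_1_over_n)
  then have "(\<lambda>k. x + 1 / real (Suc k)) \<longlonglongrightarrow> x"
    by simp
  then have "(\<lambda>k. of_rat (q k)) \<longlonglongrightarrow> x"
    \<comment> \<open>The lower bound is the constant \<open>x\<close>. The rotation puts the limit
      of the upper bound first, to be matched by the chained fact.\<close>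
    by (rule tendsto_sandwich[OF always_eventually always_eventually tendsto_const, rotated 2])
      (intro allI less_imp_le q)+
  ultimately show ?thesis
    by (intro exI[of _ q]) (auto simp: nonneg_def intro: less_imp_le)
qed

text \<open>One choice for all points at once lets whole lists and assignments be approximated
  entrywise with a common index \<open>k\<close>.\<close>

lemma nonneg_real_rat_approx:
  obtains q :: "real \<Rightarrow> nat \<Rightarrow> rat"
  where "\<And>x k. x \<in> nonneg \<Longrightarrow> q x k \<in> nonneg"
    and "\<And>x. x \<in> nonneg \<Longrightarrow> (\<lambda>k. of_rat (q x k)) \<longlonglongrightarrow> x"
proof -
  have "\<forall>x\<in>nonneg. \<exists>q. range q \<subseteq> nonneg \<and> (\<lambda>k::nat. of_rat (q k)) \<longlonglongrightarrow> (x::real)"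
    by (intro ballI nonneg_real_rat_seq)
  from bchoice[OF this] obtain q where
    "\<forall>x\<in>nonneg. range (q x) \<subseteq> nonneg \<and> (\<lambda>k::nat. of_rat (q x k)) \<longlonglongrightarrow> (x::real)" ..
  then show thesis
    by (intro that[of q]) auto
qed

text \<open>Being a non-strict inequality, \<open>gt_delta\<close> is a closed condition, so it
  survives the limit with the same \<delta>.\<close>

lemma LIMSEQ_gt_delta_of_rat:
  assumes "(\<lambda>k. of_rat (u k)) \<longlonglongrightarrow> (x::real)" "(\<lambda>k. of_rat (v k)) \<longlonglongrightarrow> y"
    and "\<And>k. gt_delta \<delta> (u k) (v k)"
  shows "gt_delta (of_rat \<delta>) x y"
proof -
  have "of_rat \<delta> \<le> of_rat (u k) - (of_rat (v k) :: real)" for k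
    using assms(3)[of k] by (simp add: gt_delta_def of_rat_less_eq flip: of_rat_diff)
  then show ?thesis
    unfolding gt_delta_def
    by (intro LIMSEQ_le_const[OF tendsto_diff[OF assms(1,2)]]) auto
qed

lemma well_defined_real_mpoly:
  assumes "p \<in> polys_in n" "well_defined_poly n p"
  shows "well_defined_poly n (real_mpoly p)"
  unfolding well_defined_poly_def
proof (intro allI impI)
  fix xs :: "real list"
  assume xs: "length xs = n \<and> set xs \<subseteq> nonneg"
  obtain q :: "real \<Rightarrow> nat \<Rightarrow> rat" where q: "\<And>x k. x \<in> nonneg \<Longrightarrow> q x k \<in> nonneg"
      "\<And>x. x \<in> nonneg \<Longrightarrow> (\<lambda>k. of_rat (q x k)) \<longlonglongrightarrow> x"
    by (fact nonneg_real_rat_approx)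
  define qs where "qs k = map (\<lambda>x. q x k) xs" for k
  have "length (qs k) = n \<and> set (qs k) \<subseteq> nonneg" for k
    using xs q(1) by (auto simp: qs_def subset_iff)
  then have "mpoly_eval p (qs k) \<in> nonneg" for k
    using assms(2) unfolding well_defined_poly_def by blast
  then have "0 \<le> (of_rat (mpoly_eval p (qs k)) :: real)" for k
    by (simp add: nonneg_def)
  moreover have "(\<lambda>k. of_rat (mpoly_eval p (qs k))) \<longlonglongrightarrow> mpoly_eval (real_mpoly p) xs"
    using xs q(2) by (intro tendsto_mpoly_eval_of_rat[OF assms(1)]) (auto simp: qs_def subset_iff)
  ultimately show "mpoly_eval (real_mpoly p) xs \<in> nonneg"
    unfolding nonneg_def by (auto intro: LIMSEQ_le_const)
qed

text \<open>Here the premise is itself a \<open>gt_delta\<close> condition, so the approximants have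
  to satisfy it too. Approximating \<open>xs ! i\<close> and \<open>b\<close> independently could
  violate it when their distance is exactly \<delta>.\<close>

lemma monotone_real_mpoly:
  assumes "p \<in> polys_in n" "monotone_poly n \<delta> p" "0 < \<delta>"
  shows "monotone_poly n (of_rat \<delta>) (real_mpoly p)"
  unfolding monotone_poly_def
proof (intro allI impI)
  fix xs :: "real list" and b i
  assume i: "i < n"
    and xs: "length xs = n \<and> set xs \<subseteq> nonneg \<and> b \<in> nonneg \<and> gt_delta (of_rat \<delta>) (xs ! i) b"
  obtain q :: "real \<Rightarrow> nat \<Rightarrow> rat" where q: "\<And>x k. x \<in> nonneg \<Longrightarrow> q x k \<in> nonneg"
      "\<And>x. x \<in> nonneg \<Longrightarrow> (\<lambda>k. of_rat (q x k)) \<longlonglongrightarrow> x"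
    by (fact nonneg_real_rat_approx)
  \<comment> \<open>Approximating \<open>xs ! i\<close> through the slack \<open>c\<close> keeps the distance \<open>\<delta>\<close> to the approximation of \<open>b\<close>.\<close>
  define c where "c = xs ! i - b - of_rat \<delta>"
  have c: "c \<in> nonneg"
    using xs by (simp add: c_def nonneg_def gt_delta_def)
  define as where "as k = (map (\<lambda>x. q x k) xs)[i := q b k + \<delta> + q c k]" for k
  have "q b k + \<delta> + q c k \<in> nonneg" for k
    using q(1)[of b k] q(1)[of c k] xs c assms(3) by (auto simp: nonneg_def)
  then have "length (as k) = n \<and> set (as k) \<subseteq> nonneg" for k
    using xs q(1) by (auto simp: as_def subset_iff dest!: set_update_subset_insert[THEN subsetD])
  moreover have "gt_delta \<delta> (as k ! i) (q b k)" for k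
    using q(1)[OF c, of k] i xs by (simp add: as_def gt_delta_def nonneg_def)
  ultimately have gt: "gt_delta \<delta> (mpoly_eval p (as k)) (mpoly_eval p ((as k)[i := q b k]))" for k
    using assms(2) i xs q(1)[of b k] unfolding monotone_poly_def by blast
  \<comment> \<open>By the choice of \<open>c\<close>, the limit
    \<open>b + of_rat \<delta> + c\<close> is \<open>xs ! i\<close>, so the specially built entry
    still converges to the right value.\<close>
  have "(\<lambda>k. of_rat (q b k) + of_rat \<delta> + of_rat (q c k)) \<longlonglongrightarrow> b + of_rat \<delta> + c"
    using xs c by (intro tendsto_intros q(2)) auto
  then have "(\<lambda>k. of_rat (q b k + \<delta> + q c k)) \<longlonglongrightarrow> xs ! i"
    by (simp add: of_rat_add c_def)
  then have "(\<lambda>k. of_rat (as k ! j)) \<longlonglongrightarrow> xs ! j" if "j < n" for j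
    using that i xs q(2) by (cases "j = i") (auto simp: as_def subset_iff)
  then have "(\<lambda>k. of_rat (mpoly_eval p (as k))) \<longlonglongrightarrow> mpoly_eval (real_mpoly p) xs"
    using xs by (intro tendsto_mpoly_eval_of_rat[OF assms(1)]) (auto simp: as_def)
  moreover have "(\<lambda>k. of_rat ((as k)[i := q b k] ! j)) \<longlonglongrightarrow> xs[i := b] ! j" if "j < n" for j
    using that i xs q(2) by (cases "j = i") (auto simp: as_def subset_iff)
  then have "(\<lambda>k. of_rat (mpoly_eval p ((as k)[i := q b k])))
      \<longlonglongrightarrow> mpoly_eval (real_mpoly p) (xs[i := b])"
    using xs by (intro tendsto_mpoly_eval_of_rat[OF assms(1)]) (auto simp: as_def)
  ultimately show "gt_delta (of_rat \<delta>) (mpoly_eval (real_mpoly p) xs)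
      (mpoly_eval (real_mpoly p) (xs[i := b]))"
    using gt by (rule LIMSEQ_gt_delta_of_rat)
qed

lemma compatible_real_mpoly:
  fixes R :: "('f, 'v) rule set"
  assumes "is_trs F ar R" "\<And>f. f \<in> F \<Longrightarrow> I f \<in> polys_in (ar f)" "compatible \<delta> I R"
  shows "compatible (of_rat \<delta>) (real_mpoly \<circ> I) R"
  unfolding compatible_def
proof (intro ballI case_prodI2 allI impI)
  fix lr l r and \<alpha> :: "'v \<Rightarrow> real"
  assume lr: "lr \<in> R" "lr = (l, r)" and \<alpha>: "range \<alpha> \<subseteq> nonneg"
  obtain q :: "real \<Rightarrow> nat \<Rightarrow> rat" where q: "\<And>x k. x \<in> nonneg \<Longrightarrow> q x k \<in> nonneg"
      "\<And>x. x \<in> nonneg \<Longrightarrow> (\<lambda>k. of_rat (q x k)) \<longlonglongrightarrow> x"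
    by (fact nonneg_real_rat_approx)
  \<comment> \<open>Values are rounded variable by variable; pointwise convergence suffices because
    evaluating a term is a finite composition of polynomials.\<close>
  define \<beta> where "\<beta> k x = q (\<alpha> x) k" for k x
  have wf: "wf_trm F ar l" "wf_trm F ar r"
    using assms(1) lr by (auto simp: is_trs_def)
  have "range (\<beta> k) \<subseteq> nonneg" for k
    using q(1) \<alpha> by (simp add: \<beta>_def image_subset_iff)
  then have gt: "gt_delta \<delta> (eval_trm I (\<beta> k) l) (eval_trm I (\<beta> k) r)" for k
    using assms(3) lr by (auto simp: compatible_def dest!: bspec)
  have "(\<lambda>k. of_rat (\<beta> k x)) \<longlonglongrightarrow> \<alpha> x" for x
    using q(2) \<alpha> by (simp add: \<beta>_def image_subset_iff)
  note lim = tendsto_eval_trm_of_rat[OF _ assms(2) this]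
  show "gt_delta (of_rat \<delta>) (eval_trm (real_mpoly \<circ> I) \<alpha> l) (eval_trm (real_mpoly \<circ> I) \<alpha> r)"
    using lim[OF wf(1)] lim[OF wf(2)] gt by (rule LIMSEQ_gt_delta_of_rat)
qed

theorem theorem3p2:
  fixes F :: "'f set" and ar :: "'f \<Rightarrow> nat" and R :: "('f, 'v) rule set"
  assumes "is_trs F ar R"
    and "polynomially_terminating TYPE(rat) F ar R"
  shows "polynomially_terminating TYPE(real) F ar R"
proof -
  obtain \<delta> :: rat and I where I: "poly_interpretation F ar \<delta> I" "strictly_monotone F ar \<delta> I"
      "compatible \<delta> I R"
    using assms(2) unfolding polynomially_terminating_def by blast
  have "poly_interpretation F ar (of_rat \<delta> :: real) (real_mpoly \<circ> I)"
    using I(1) by (auto simp: poly_interpretation_def real_mpoly_in_polys_in well_defined_real_mpoly)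
  \<comment> \<open>Besides rational monotonicity this draws on \<open>poly_interpretation\<close>
    for \<open>0 < \<delta>\<close> and for the bound on the indeterminates.\<close>
  moreover have "strictly_monotone F ar (of_rat \<delta> :: real) (real_mpoly \<circ> I)"
    using I(1,2) by (auto simp: strictly_monotone_def poly_interpretation_def monotone_real_mpoly)
  moreover have "compatible (of_rat \<delta> :: real) (real_mpoly \<circ> I) R"
    using I(1,3) by (intro compatible_real_mpoly[OF assms(1)]) (auto simp: poly_interpretation_def)
  ultimately show ?thesis
    unfolding polynomially_terminating_def by blast
qed

end
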